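(* Let $\mathcal A$ and $\mathcal B$ be non-empty finite alphabets, let $X \subset \mathcal A^{\mathbb Z}$ be a subshift, let $\sigma: \mathcal A^* \to \mathcal B^*$ be a non-erasing morphism of free monoids, and let $Y := \sigma(X)\subset \mathcal B^{\mathbb Z}$ be the image subshift of $X$. Let $p_X$ and $p_Y$ denote the complexity functions of $X$ and $Y$. Then: (1) There exists a constant $C>0$ such that $p_Y(n) \le C\cdot p_X(n)$ for all $n \in \mathbb N$. Indeed, one can take $C = \max\{|\sigma(a)| : a \in \mathcal A\}$. (2) If $\sigma$ is recognizable in $X$ and letter-to-letter, then there exists a constant $c>0$ such that $c\cdot p_X(n) \le p_Y(n)$ for all sufficiently large integers $n \in \mathbb N$. (3) If $\sigma$ is recognizable in $X$ (but not necessarily letter-to-letter), then there exist constants $c>0$ and $d>0$ such that $c\cdot p_X(\lfloor d\cdot n\rfloor) \le p_Y(n)$ for all sufficiently large integers $n\in \mathbb N$. (4) There exist non-empty finite alphabets $\mathcal A, \mathcal B$, a subshift $X \subset \mathcal A^{\mathbb Z}$ and a non-erasing morphism $\sigma:\mathcal A^*\to\mathcal B^*$ which is recognizable in $X$ such that, with $Y=\sigma(X)$, for every constant $c>0$ one has $c\cdot p_X(n) > p_Y(n)$ for infinitely many integers $n \in \mathbb N$.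
   Context: For a finite alphabet $\mathcal A$, $\mathcal A^*$ is the free monoid of finite words in $\mathcal A$ and $|w|$ is the length of a word $w$. The space $\mathcal A^{\mathbb Z}$ of biinfinite words ${\bf x} = \ldots x_{n-1}x_nx_{n+1}\ldots$ carries the product topology (with $\mathcal A$ discrete), and the shift operator $T_{\mathcal A}$ acts on it by decreasing all indices by 1, i.e. $(T_{\mathcal A}{\bf x})_n = x_{n+1}$. A subshift over $\mathcal A$ is a non-empty closed subset $X\subset\mathcal A^{\mathbb Z}$ with $T_{\mathcal A}(X)=X$. A factor of a (finite or biinfinite) word is a finite word occurring in it as a block of consecutive letters. The language $\mathcal L(X)\subset \mathcal A^*$ is the set of all factors of elements of $X$. The complexity function $p_X:\mathbb N\to\mathbb N$ is $p_X(n) = $ the number of words of length $n$ in $\mathcal L(X)$. A monoid morphism $\sigma:\mathcal A^*\to\mathcal B^*$ is non-erasing if $\sigma(a)$ is not the empty word for any $a \in\mathcal A$, and letter-to-letter if $|\sigma(a)|=1$ for all $a\in\mathcal A$. The image subshift $\sigma(X)\subset\mathcal B^{\mathbb Z}$ is the set of all ${\bf y}\in\mathcal B^{\mathbb Z}$ such that every factor of ${\bf y}$ is a factor of $\sigma(w)$ for some $w\in\mathcal L(X)$. A non-erasing $\sigma$ acts on ${\bf x}\in\mathcal A^{\mathbb Z}$ by $\sigma({\bf x}) = \ldots y_{-1}y_0y_1\ldots$ where $y_1y_2\ldots = \sigma(x_1)\sigma(x_2)\ldots$ and $\ldots y_{-1}y_0 = \ldots\sigma(x_{-1})\sigma(x_0)$.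 The morphism $\sigma$ is recognizable in $X$ if the following holds: whenever ${\bf x},{\bf x'}\in X$ and ${\bf y}\in\mathcal B^{\mathbb Z}$ satisfy ${\bf y}=T_{\mathcal B}^k(\sigma({\bf x}))$ and ${\bf y}=T_{\mathcal B}^\ell(\sigma({\bf x'}))$ for integers $0\le k\le|\sigma(x_1)|-1$ and $0\le\ell\le|\sigma(x_1')|-1$, then ${\bf x}={\bf x'}$ and $k=\ell$. *)

theory Defs
  imports "HOL-Analysis.Function_Topology" "HOL-Library.Sublist"
begin

text \<open>An alphabet is a set \<open>A\<close> of letters and \<open>A\<^sup>*\<close> is \<^term>\<open>lists A\<close>. Alphabets are sets rather than
  types so that one can quantify over them existentially.\<close>

definition full_shift :: "'a set \<Rightarrow> (int \<Rightarrow> 'a) topology" where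
  "full_shift A = product_topology (\<lambda>_. discrete_topology A) UNIV"

definition shift_op :: "(int \<Rightarrow> 'a) \<Rightarrow> (int \<Rightarrow> 'a)" where
  "shift_op x = (\<lambda>n. x (n + 1))"

definition subshift :: "'a set \<Rightarrow> (int \<Rightarrow> 'a) set \<Rightarrow> bool" where
  "subshift A X \<longleftrightarrow> X \<noteq> {} \<and> closedin (full_shift A) X \<and> shift_op ` X = X"

text \<open>Factors of finite words are given by \<^const>\<open>sublist\<close> (contiguous blocks). The empty word is a
  factor of every word.\<close>

definition biinf_factor :: "'a list \<Rightarrow> (int \<Rightarrow> 'a) \<Rightarrow> bool" where
  "biinf_factor u x \<longleftrightarrow> (\<exists>m. u = map (\<lambda>i. x (m + int i)) [0..<length u])"

definition language :: "(int \<Rightarrow> 'a) set \<Rightarrow> 'a list set" where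
  "language X = {u. \<exists>x\<in>X. biinf_factor u x}"

definition complexity :: "(int \<Rightarrow> 'a) set \<Rightarrow> nat \<Rightarrow> nat" where
  "complexity X n = card {w \<in> language X. length w = n}"

definition free_monoid_morphism :: "'a set \<Rightarrow> 'b set \<Rightarrow> ('a list \<Rightarrow> 'b list) \<Rightarrow> bool" where
  "free_monoid_morphism A B \<sigma> \<longleftrightarrow>
     (\<forall>u\<in>lists A. \<sigma> u \<in> lists B) \<and>
     \<sigma> [] = [] \<and>
     (\<forall>u\<in>lists A. \<forall>v\<in>lists A. \<sigma> (u @ v) = \<sigma> u @ \<sigma> v)"

definition non_erasing :: "'a set \<Rightarrow> ('a list \<Rightarrow> 'b list) \<Rightarrow> bool" where
  "non_erasing A \<sigma> \<longleftrightarrow> (\<forall>a\<in>A. \<sigma> [a] \<noteq> [])"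

definition letter_to_letter :: "'a set \<Rightarrow> ('a list \<Rightarrow> 'b list) \<Rightarrow> bool" where
  "letter_to_letter A \<sigma> \<longleftrightarrow> (\<forall>a\<in>A. length (\<sigma> [a]) = 1)"

definition image_subshift :: "'b set \<Rightarrow> ('a list \<Rightarrow> 'b list) \<Rightarrow> (int \<Rightarrow> 'a) set \<Rightarrow> (int \<Rightarrow> 'b) set" where
  "image_subshift B \<sigma> X =
     {y \<in> topspace (full_shift B). \<forall>u. biinf_factor u y \<longrightarrow> (\<exists>w\<in>language X. sublist u (\<sigma> w))}"

text \<open>The biinfinite word \<open>\<sigma>(x) = \<dots> y\<^sub>-\<^sub>1 y\<^sub>0 y\<^sub>1 \<dots>\<close> with \<open>y\<^sub>1 y\<^sub>2 \<dots> = \<sigma>(x\<^sub>1) \<sigma>(x\<^sub>2) \<dots>\<close> and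
  \<open>\<dots> y\<^sub>-\<^sub>1 y\<^sub>0 = \<dots> \<sigma>(x\<^sub>-\<^sub>1) \<sigma>(x\<^sub>0)\<close>. For non-erasing \<open>\<sigma>\<close>, the word \<open>\<sigma>(x\<^sub>1 \<dots> x\<^sub>n)\<close> has length at least
  \<open>n\<close> and so determines \<open>y\<^sub>n\<close> if \<open>n \<ge> 1\<close>; likewise \<open>\<sigma>(x\<^sub>n \<dots> x\<^sub>0)\<close>, read from its right end, determines
  \<open>y\<^sub>n\<close> if \<open>n \<le> 0\<close>. The definition is meaningful for non-erasing \<open>\<sigma>\<close> only.\<close>

definition biinf_image :: "('a list \<Rightarrow> 'b list) \<Rightarrow> (int \<Rightarrow> 'a) \<Rightarrow> (int \<Rightarrow> 'b)" where
  "biinf_image \<sigma> x =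
     (\<lambda>n. if n \<ge> 1 then \<sigma> (map x [1..n]) ! nat (n - 1)
          else rev (\<sigma> (map x [n..0])) ! nat (- n))"

definition recognizable :: "'b set \<Rightarrow> ('a list \<Rightarrow> 'b list) \<Rightarrow> (int \<Rightarrow> 'a) set \<Rightarrow> bool" where
  "recognizable B \<sigma> X \<longleftrightarrow>
     (\<forall>x\<in>X. \<forall>x'\<in>X. \<forall>y\<in>topspace (full_shift B). \<forall>k l :: nat.
        k < length (\<sigma> [x 1]) \<longrightarrow> l < length (\<sigma> [x' 1]) \<longrightarrow>
        y = (shift_op ^^ k) (biinf_image \<sigma> x) \<longrightarrow> y = (shift_op ^^ l) (biinf_image \<sigma> x') \<longrightarrow>
        x = x' \<and> k = l)"

end

theory Submission
  imports Defs
begin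

text \<open>A word of length \<open>n\<close> in \<open>\<sigma>(X)\<close> is determined by an \<open>X\<close>-word \<open>v\<close> of length \<open>n\<close> and its starting
  offset inside the image of the first letter of \<open>v\<close>, which gives (1).

  For the lower bounds, recognizability with \<open>k = l = 0\<close> and compactness give an \<open>N\<close> such that the
  window of \<open>\<sigma>(x)\<close> of radius \<open>N\<close> around the start of \<open>\<sigma>(x\<^sub>1)\<close> determines \<open>x\<^sub>1\<close>. If \<open>|\<sigma>(a)| \<le> M\<close> for
  all letters and \<open>M m \<le> n\<close>, then \<open>w = x\<^sub>1 \<dots> x\<^sub>m\<close> can be reconstructed from left to right from its
  first and last \<open>N\<close> letters and the first \<open>n\<close> letters of \<open>\<sigma>(x)\<close>: the letters already known
  locate the start of the image of the next one. Hence \<open>p\<^sub>X(m) \<le> K p\<^sub>Y(n)\<close> with \<open>K\<close> depending only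
  on \<open>N\<close> and the alphabet; \<open>M = 1\<close> is (2).

  For (4), take the full shift on \<open>{1, 2}\<close> and \<open>\<sigma>(a) = 0 a\<close>: the positions of \<open>0\<close> make \<open>\<sigma>\<close>
  recognizable, while \<open>p\<^sub>X(2m) = 4\<^sup>m\<close> and \<open>p\<^sub>Y(2m) \<le> 4 \<cdot> 2\<^sup>m\<close>.\<close>

section \<open>Factors, translates and languages of biinfinite words\<close>

lemma map_upto_shift: "map (\<lambda>i. x (i + j)) [a..b] = map x [a + j..b + (j::int)]"
  by (rule nth_equalityI) (auto simp: nth_upto algebra_simps)

text \<open>Integer intervals replace the natural-number index so that factors can be split and
  translated with facts on \<open>upto\<close>.\<close>

lemma biinf_factor_iff: "biinf_factor u x \<longleftrightarrow> (\<exists>m. u = map x [m..m + int (length u) - 1])"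
proof -
  have "map (\<lambda>i. x (m + int i)) [0..<l] = map x [m..m + int l - 1]" for m l
    by (rule nth_equalityI) (auto simp: nth_upto)
  then show ?thesis by (simp add: biinf_factor_def)
qed

lemma topspace_full_shift: "topspace (full_shift A) = {x. \<forall>i. x i \<in> A}"
  by (auto simp: full_shift_def PiE_UNIV_domain)

lemma subshift_range: "subshift A X \<Longrightarrow> x \<in> X \<Longrightarrow> x i \<in> A"
  using closedin_subset topspace_full_shift by (fastforce simp: subshift_def)

lemma shift_op_funpow: "(shift_op ^^ k) x = (\<lambda>i. x (i + int k))"
  by (induction k) (auto simp: shift_op_def algebra_simps)

text \<open>Shift invariance is an equality of sets. One inclusion gives forward translates; the
  other provides a preimage under the shift, which is forced pointwise to be the backward
  translate.\<close>

lemma subshift_translate: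
  assumes "subshift A X" "x \<in> X"
  shows "(\<lambda>i. x (i + j)) \<in> X"
proof -
  have X: "shift_op ` X = X" using assms(1) by (simp add: subshift_def)
  have fwd: "(\<lambda>i. x (i + int k)) \<in> X" if "x \<in> X" for x k
  proof -
    have "(shift_op ^^ k) x \<in> X" using that X by (induction k) auto
    then show ?thesis by (simp add: shift_op_funpow)
  qed
  have bwd: "(\<lambda>i. x (i - int k)) \<in> X" if "x \<in> X" for x k
  proof (induction k)
    case (Suc k)
    then obtain z where z: "z \<in> X" "(\<lambda>i. x (i - int k)) = shift_op z" using X by blast
    have "z i = x (i - int (Suc k))" for i
      using fun_cong[OF z(2), of "i - 1"] by (simp add: shift_op_def algebra_simps)
    then have "z = (\<lambda>i. x (i - int (Suc k)))" by blast
    then show ?case using z(1) by simp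
  qed (use that in simp)
  show ?thesis
    using fwd[OF assms(2), of "nat j"] bwd[OF assms(2), of "nat (- j)"] by (cases "j \<ge> 0") auto
qed

text \<open>Any occurrence of a word can be translated to the positions 1 to \<open>n\<close>. Every
  word thus has a representative in \<open>X\<close> that reads it there.\<close>

lemma language_length_eq:
  assumes "subshift A X"
  shows "{w \<in> language X. length w = n} = (\<lambda>x. map x [1..int n]) ` X"
proof (intro set_eqI iffI)
  fix w assume "w \<in> {w \<in> language X. length w = n}"
  then obtain x m where x: "x \<in> X" and w: "w = map x [m..m + int n - 1]"
    by (auto simp: language_def biinf_factor_iff)
  have "w = map (\<lambda>i. x (i + (m - 1))) [1..int n]"
    unfolding map_upto_shift w by (simp add: algebra_simps)
  then show "w \<in> (\<lambda>x. map x [1..int n]) ` X" using subshift_translate[OF assms x] by blast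
next
  fix w assume "w \<in> (\<lambda>x. map x [1..int n]) ` X"
  then show "w \<in> {w \<in> language X. length w = n}"
    by (force simp: language_def biinf_factor_iff intro: exI[of _ 1])
qed

lemma language_lists:
  assumes "\<And>x i. x \<in> X \<Longrightarrow> x i \<in> A" "w \<in> language X"
  shows "w \<in> lists A"
proof -
  obtain x m where "x \<in> X" "w = map x [m..m + int (length w) - 1]"
    using assms(2) by (auto simp: language_def biinf_factor_iff)
  then have "set w \<subseteq> range x" by (metis image_mono list.set_map subset_UNIV)
  then show ?thesis using assms(1) \<open>x \<in> X\<close> by auto
qed

text \<open>Phrased by the range of the letters so that it serves the image subshift as well as
  \<open>X\<close>.\<close>

lemma finite_language_length:
  assumes "finite A" "\<And>x i. x \<in> X \<Longrightarrow> x i \<in> A"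
  shows "finite {w \<in> language X. length w = n}"
proof (rule finite_subset[OF _ finite_lists_length_eq[OF assms(1), of n]])
  show "{w \<in> language X. length w = n} \<subseteq> {w. set w \<subseteq> A \<and> length w = n}"
    using language_lists[of X A] assms(2) by (auto simp: in_lists_conv_set)
qed

section \<open>Compactness of subshifts\<close>

text \<open>Were \<open>z\<close> outside the closed set \<open>X\<close>, a basic open box around
  \<open>z\<close> restricting finitely many coordinates would miss \<open>X\<close>. A point of
  \<open>X\<close> that agrees with \<open>z\<close> on a window containing these coordinates lies
  in the box.\<close>

lemma subshift_limit:
  assumes "subshift A X" "\<And>i. z i \<in> A" "\<And>N::nat. \<exists>x\<in>X. \<forall>i. \<bar>i\<bar> \<le> int N \<longrightarrow> x i = z i"
  shows "z \<in> X"
proof (rule ccontr)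
  assume "z \<notin> X"
  have "openin (full_shift A) (topspace (full_shift A) - X)"
    using assms(1) by (auto simp: subshift_def)
  moreover have "z \<in> topspace (full_shift A) - X"
    using \<open>z \<notin> X\<close> assms(2) by (simp add: topspace_full_shift)
  ultimately have "\<exists>U. finite {i. U i \<noteq> A} \<and> z \<in> PiE UNIV U \<and> PiE UNIV U \<subseteq> topspace (full_shift A) - X"
    unfolding full_shift_def openin_product_topology_alt by (auto dest: bspec)
  then obtain U where U: "finite {i. U i \<noteq> A}" "z \<in> PiE UNIV U" "PiE UNIV U \<subseteq> topspace (full_shift A) - X"
    by blast
  obtain N :: nat where N: "\<forall>i \<in> {i. U i \<noteq> A}. \<bar>i\<bar> \<le> int N"
  proof
    show "\<forall>i \<in> {i. U i \<noteq> A}. \<bar>i\<bar> \<le> int (Max (insert 0 ((\<lambda>i. nat \<bar>i\<bar>) ` {i. U i \<noteq> A})))"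
    proof
      fix i assume "i \<in> {i. U i \<noteq> A}"
      then have "nat \<bar>i\<bar> \<le> Max (insert 0 ((\<lambda>i. nat \<bar>i\<bar>) ` {i. U i \<noteq> A}))"
        using U(1) by (intro Max_ge) auto
      then show "\<bar>i\<bar> \<le> int (Max (insert 0 ((\<lambda>i. nat \<bar>i\<bar>) ` {i. U i \<noteq> A})))" by linarith
    qed
  qed
  obtain x where x: "x \<in> X" "\<forall>i. \<bar>i\<bar> \<le> int N \<longrightarrow> x i = z i" using assms(3) by blast
  have "x i \<in> U i" for i
    using N x U(2) subshift_range[OF assms(1) x(1), of i] by (cases "U i = A") (auto simp: PiE_UNIV_domain Pi_iff)
  then show False using U(3) x(1) by (auto simp: PiE_UNIV_domain)
qed

text \<open>A diagonal argument: a window carries finitely many patterns, so infinitely many indices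
  share one, and this choice is refined along growing windows.\<close>

lemma biinfinite_cluster_word:
  fixes f :: "nat \<Rightarrow> int \<Rightarrow> 'c"
  assumes "finite S" "\<And>n i. f n i \<in> S"
  shows "\<exists>z. \<forall>N::nat. \<exists>n\<ge>N. \<forall>i. \<bar>i\<bar> \<le> int N \<longrightarrow> f n i = z i"
proof -
  \<comment> \<open>The invariant of the recursion. Infinitude allows the next use of the pigeonhole
    principle and, at the end, the choice of an index \<open>n \<ge> N\<close>.\<close>
  define P where "P = (\<lambda>(N::nat) g. infinite {n. \<forall>i. \<bar>i\<bar> \<le> int N \<longrightarrow> f n i = g i})"
  have refine: "\<exists>m\<in>I. infinite {n \<in> I. \<forall>i. \<bar>i\<bar> \<le> int N \<longrightarrow> f n i = f m i}" if "infinite I" for I N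
  proof -
    let ?W = "{- int N..int N}"
    have "finite ((\<lambda>n. restrict (f n) ?W) ` I)"
      by (rule finite_subset[of _ "PiE ?W (\<lambda>_. S)"]) (use assms in \<open>auto intro!: finite_PiE\<close>)
    then have "\<exists>m\<in>I. infinite {n \<in> I. restrict (f n) ?W = restrict (f m) ?W}"
      by (intro pigeonhole_infinite that)
    then obtain m where m: "m \<in> I" "infinite {n \<in> I. restrict (f n) ?W = restrict (f m) ?W}" by blast
    have "{n \<in> I. restrict (f n) ?W = restrict (f m) ?W} \<subseteq> {n \<in> I. \<forall>i. \<bar>i\<bar> \<le> int N \<longrightarrow> f n i = f m i}"
      by (auto simp: restrict_def fun_eq_iff abs_le_iff)
    then show ?thesis using m finite_subset by blast
  qed
  have "\<exists>G. \<forall>N. P N (G N) \<and> (\<forall>i. \<bar>i\<bar> \<le> int N \<longrightarrow> G (Suc N) i = G N i)"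
  proof (rule dependent_nat_choice)
    show "\<exists>g. P 0 g" using refine[of UNIV 0] by (auto simp: P_def)
  next
    fix g N assume "P N g"
    then obtain m where m: "\<forall>i. \<bar>i\<bar> \<le> int N \<longrightarrow> f m i = g i"
      "infinite {n \<in> {n. \<forall>i. \<bar>i\<bar> \<le> int N \<longrightarrow> f n i = g i}. \<forall>i. \<bar>i\<bar> \<le> int (Suc N) \<longrightarrow> f n i = f m i}"
      using refine[of "{n. \<forall>i. \<bar>i\<bar> \<le> int N \<longrightarrow> f n i = g i}" "Suc N"] unfolding P_def by blast
    have "P (Suc N) (f m)"
      unfolding P_def by (rule infinite_super[OF _ m(2)]) auto
    then show "\<exists>g'. P (Suc N) g' \<and> (\<forall>i. \<bar>i\<bar> \<le> int N \<longrightarrow> g' i = g i)" using m(1) by blast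
  qed
  then obtain G where G: "\<And>N. P N (G N)" "\<And>N i. \<bar>i\<bar> \<le> int N \<Longrightarrow> G (Suc N) i = G N i" by blast
  \<comment> \<open>The limit at \<open>i\<close> is read off at the first window that contains
    \<open>i\<close>; later windows do not change it.\<close>
  have stable: "G N i = G (nat \<bar>i\<bar>) i" if "nat \<bar>i\<bar> \<le> N" for N i
    using that by (induction N rule: dec_induct) (use G(2) in auto)
  show ?thesis
  proof (rule exI, rule allI)
    fix N
    obtain n where "n \<ge> N" "\<forall>i. \<bar>i\<bar> \<le> int N \<longrightarrow> f n i = G N i"
      using G(1)[of N] unfolding P_def infinite_nat_iff_unbounded_le by blast
    then show "\<exists>n\<ge>N. \<forall>i. \<bar>i\<bar> \<le> int N \<longrightarrow> f n i = G (nat \<bar>i\<bar>) i"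
      using stable by (metis nat_le_iff)
  qed
qed

section \<open>Images of finite words under a non-erasing morphism\<close>

lemma take_drop_prefix: "prefix s t \<Longrightarrow> k + n \<le> length s \<Longrightarrow> take n (drop k s) = take n (drop k t)"
  by (auto simp: prefix_def)

lemma sublist_take_drop: "sublist (take n (drop k t)) t"
  by (meson sublist_drop sublist_order.order.trans sublist_take)

locale non_erasing_morphism =
  fixes A :: "'a set" and B :: "'b set" and \<sigma> :: "'a list \<Rightarrow> 'b list"
  assumes morphism: "free_monoid_morphism A B \<sigma>"
    and non_erasing: "non_erasing A \<sigma>"
begin

lemma image_Nil [simp]: "\<sigma> [] = []"
  using morphism by (simp add: free_monoid_morphism_def)

lemma image_append: "u \<in> lists A \<Longrightarrow> v \<in> lists A \<Longrightarrow> \<sigma> (u @ v) = \<sigma> u @ \<sigma> v"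
  using morphism by (simp add: free_monoid_morphism_def)

lemma image_Cons: "a \<in> A \<Longrightarrow> v \<in> lists A \<Longrightarrow> \<sigma> (a # v) = \<sigma> [a] @ \<sigma> v"
  using image_append[of "[a]" v] by simp

lemma image_lists: "u \<in> lists A \<Longrightarrow> \<sigma> u \<in> lists B"
  using morphism by (simp add: free_monoid_morphism_def)

lemma image_letter: "a \<in> A \<Longrightarrow> Suc 0 \<le> length (\<sigma> [a])"
  using non_erasing by (simp add: non_erasing_def Suc_le_eq)

lemma prefix_image: "prefix u v \<Longrightarrow> v \<in> lists A \<Longrightarrow> prefix (\<sigma> u) (\<sigma> v)"
  by (auto simp: prefix_def image_append in_lists_conv_set)

text \<open>The bound \<open>r\<close> is kept general: \<open>r = 1\<close> is the non-erasing
  case, \<open>r = 2\<close> serves the example.\<close>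

lemma length_image_ge:
  assumes "\<And>a. a \<in> A \<Longrightarrow> r \<le> length (\<sigma> [a])" "w \<in> lists A"
  shows "r * length w \<le> length (\<sigma> w)"
  using assms(2)
proof (induction w)
  case (Cons a w)
  then show ?case using assms(1)[of a] by (simp add: image_Cons[of a w])
qed simp

lemma length_image_le:
  assumes "\<And>a. a \<in> A \<Longrightarrow> length (\<sigma> [a]) \<le> M" "w \<in> lists A"
  shows "length (\<sigma> w) \<le> M * length w"
  using assms(2)
proof (induction w)
  case (Cons a w)
  then show ?case using assms(1)[of a] by (simp add: image_Cons[of a w])
qed simp

lemmas length_le_length_image = length_image_ge[OF image_letter, simplified]

lemma locate_letter:
  assumes "w \<in> lists A" "i < length (\<sigma> w)"
  shows "\<exists>w1 a w2 k. w = w1 @ a # w2 \<and> k < length (\<sigma> [a]) \<and> i = length (\<sigma> w1) + k"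
  using assms
proof (induction w arbitrary: i)
  case (Cons b w)
  show ?case
  proof (cases "i < length (\<sigma> [b])")
    case True
    then show ?thesis by (intro exI[of _ "[]"] exI[of _ b] exI[of _ w] exI[of _ i]) simp
  next
    case False
    then have "i - length (\<sigma> [b]) < length (\<sigma> w)"
      using Cons.prems Cons.hyps by (simp add: image_Cons[of b w])
    then obtain w1 a w2 k where "w = w1 @ a # w2" "k < length (\<sigma> [a])"
        "i - length (\<sigma> [b]) = length (\<sigma> w1) + k"
      using Cons.IH by blast
    moreover from this have "w1 \<in> lists A" using Cons.hyps by simp
    then have "length (\<sigma> (b # w1)) = length (\<sigma> [b]) + length (\<sigma> w1)"
      using Cons.hyps by (simp add: image_Cons[of b w1])
    ultimately show ?thesis using False
      by (intro exI[of _ "b # w1"] exI[of _ a] exI[of _ w2] exI[of _ k]) auto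
  qed
qed simp

section \<open>Upper bound for the complexity of the image\<close>

text \<open>A factor \<open>u\<close> of length \<open>n\<close> starts inside the image of some
  letter. From there, this letter contributes at least one letter and the following
  \<open>m - 1\<close> letters at least \<open>r\<close> each, so \<open>m\<close> letters cover
  \<open>u\<close>. Hence \<open>u\<close> is determined by a word of length \<open>m\<close> and
  one of at most \<open>M\<close> offsets.\<close>

lemma complexity_image_le:
  assumes "finite A" "subshift A X"
    and M: "\<And>a. a \<in> A \<Longrightarrow> length (\<sigma> [a]) \<le> M"
    and r: "\<And>a. a \<in> A \<Longrightarrow> r \<le> length (\<sigma> [a])"
    and n: "0 < n" "0 < m" "n \<le> r * (m - 1) + 1"
  shows "complexity (image_subshift B \<sigma> X) n \<le> M * complexity X m"
proof -
  let ?L = "{w \<in> language X. length w = m}"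
  let ?F = "\<lambda>(v, k). take n (drop k (\<sigma> v))"
  have fin: "finite ?L" using finite_language_length assms(1) subshift_range[OF assms(2)] by blast
  have "{u \<in> language (image_subshift B \<sigma> X). length u = n} \<subseteq> ?F ` (?L \<times> {..<M})"
  proof
    fix u assume u: "u \<in> {u \<in> language (image_subshift B \<sigma> X). length u = n}"
    then obtain w where w: "w \<in> language X" "sublist u (\<sigma> w)"
      unfolding language_def image_subshift_def by blast
    have wA: "w \<in> lists A" using language_lists[of X A] subshift_range[OF assms(2)] w(1) by blast
    obtain p s where ps: "\<sigma> w = p @ u @ s" using w(2) by (auto simp: sublist_def)
    have "length p < length (\<sigma> w)" using u n(1) by (simp add: ps)
    then obtain w1 a w2 k where split: "w = w1 @ a # w2" "k < length (\<sigma> [a])" "length p = length (\<sigma> w1) + k"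
      using locate_letter[OF wA] by blast
    have in_A: "a \<in> A" "w1 \<in> lists A" "a # w2 \<in> lists A" using wA split(1) by auto
    have "drop (length p) (\<sigma> w) = drop k (\<sigma> (a # w2))"
      using split(1,3) in_A by (simp add: image_append)
    then have us: "drop k (\<sigma> (a # w2)) = u @ s" by (simp add: ps)
    obtain x l where x: "x \<in> X" "w = map x [l..l + int (length w) - 1]"
      using w(1) by (auto simp: language_def biinf_factor_iff)
    define l' where "l' = l + int (length w1)"
    have aw2: "a # w2 = map x [l'..l' + int (length w2)]"
    proof -
      have "a # w2 = drop (length w1) (map x [l..l + int (length w) - 1])"
        using split(1) x(2) by (metis append_eq_conv_conj)
      also have "\<dots> = map x [l'..l' + int (length w2)]"
        by (rule nth_equalityI) (auto simp: l'_def split(1) nth_upto add.assoc)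
      finally show ?thesis .
    qed
    \<comment> \<open>\<open>v\<close> reads \<open>x\<close> from the position of \<open>a\<close>,
      possibly beyond the end of \<open>w\<close>. As \<open>a # w2\<close> starts at the same
      position, one of the two is a prefix of the other, and \<open>u\<close> can be read from
      either image.\<close>
    define v where "v = map x [l'..l' + int m - 1]"
    have v: "v \<in> ?L" unfolding v_def language_def biinf_factor_iff using x(1) by auto
    then have vA: "v \<in> lists A" using language_lists[of X A] subshift_range[OF assms(2)] by blast
    have comparable: "prefix (a # w2) v \<or> prefix v (a # w2)"
    proof (cases "Suc (length w2) \<le> m")
      case True
      then have "[l'..l' + int m - 1] = [l'..l' + int (length w2)] @ [l' + int (length w2) + 1..l' + int m - 1]"
        by (intro upto_split2) auto
      then show ?thesis by (simp add: aw2 v_def)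
    next
      case False
      then have "[l'..l' + int (length w2)] = [l'..l' + int m - 1] @ [l' + int m - 1 + 1..l' + int (length w2)]"
        using n(2) by (intro upto_split2) auto
      then show ?thesis by (simp add: aw2 v_def)
    qed
    have "v = x l' # map x [l' + 1..l' + int m - 1]"
      using n(2) by (simp add: v_def upto.simps[of l'])
    moreover have "x l' = a" using aw2 by (simp add: upto.simps[of l'])
    ultimately obtain t where t: "v = a # t" "length t = m - 1" using v by auto
    have "r * length t \<le> length (\<sigma> t)" using t(1) vA by (intro length_image_ge r) auto
    then have kv: "k + n \<le> length (\<sigma> v)"
      using t vA n(3) split(2) by (simp add: image_Cons[of a t])
    have kw: "k + n \<le> length (\<sigma> (a # w2))"
      using arg_cong[OF us, of length] u n(1) by simp
    have "take n (drop k (\<sigma> (a # w2))) = take n (drop k (\<sigma> v))"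
      using comparable
    proof
      assume "prefix (a # w2) v"
      then show ?thesis by (intro take_drop_prefix prefix_image vA kw)
    next
      assume "prefix v (a # w2)"
      then show ?thesis by (intro take_drop_prefix[symmetric] prefix_image in_A kv)
    qed
    then have "u = ?F (v, k)" using us u by simp
    moreover have "k < M" using split(2) M[OF in_A(1)] by simp
    ultimately show "u \<in> ?F ` (?L \<times> {..<M})" using v by blast
  qed
  then have "complexity (image_subshift B \<sigma> X) n \<le> card (?F ` (?L \<times> {..<M}))"
    unfolding complexity_def using fin by (intro card_mono) auto
  also have "\<dots> \<le> card (?L \<times> {..<M})" using fin by (intro card_image_le) auto
  also have "\<dots> = M * complexity X m" by (simp add: complexity_def card_cartesian_product mult.commute)
  finally show ?thesis .
qed

section \<open>The action of the morphism on biinfinite words\<close>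

lemma word_in_lists: "(\<And>i. x i \<in> A) \<Longrightarrow> map x [a..b] \<in> lists A"
  by auto

text \<open>The bounds on \<open>m\<close> admit an empty interval on either side, so that cuts at
  the ends are covered.\<close>

lemma image_upto_append:
  assumes "\<And>i. x i \<in> A" "l \<le> m + 1" "m \<le> u"
  shows "\<sigma> (map x [l..u]) = \<sigma> (map x [l..m]) @ \<sigma> (map x [m + 1..u])"
proof -
  have "[l..u] = [l..m] @ [m + 1..u]"
    using assms(2,3) upto_split2[of l m u] by (cases "l = m + 1") auto
  then show ?thesis using word_in_lists[of x, OF assms(1)] by (simp add: image_append)
qed

lemma length_image_upto:
  assumes "\<And>i. x i \<in> A"
  shows "nat (u - l + 1) \<le> length (\<sigma> (map x [l..u]))"
  using length_le_length_image[OF word_in_lists[of x, OF assms], of l u] by simp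

text \<open>\<open>biinf_image\<close> uses a different window for each coordinate. Any other window
  around the origin gives the same letter, because enlarging a window only adds letters at its ends.
  As the image of \<open>x 1\<close> starts at coordinate 1, the index is corrected by the length of
  the image of the letters up to \<open>x 0\<close>.\<close>

lemma biinf_image_window:
  assumes x: "\<And>i. x i \<in> A" and ab: "a \<le> 1" "0 \<le> b" and i: "i < length (\<sigma> (map x [a..b]))"
  shows "biinf_image \<sigma> x (int i + 1 - int (length (\<sigma> (map x [a..0])))) = \<sigma> (map x [a..b]) ! i"
proof -
  let ?P = "length (\<sigma> (map x [a..0]))"
  note split = image_upto_append[of x, OF x] and len = length_image_upto[of x, OF x]
  have ab_split: "\<sigma> (map x [a..b]) = \<sigma> (map x [a..0]) @ \<sigma> (map x [1..b])"
    using split[of a 0 b] ab by simp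
  define n where "n = int i + 1 - int ?P"
  show ?thesis
  proof (cases "i < ?P")
    case True
    then have n: "n \<le> 0" "i = nat (n - 1 + int ?P)" unfolding n_def by auto
    let ?Q = "length (\<sigma> (map x [n..0]))"
    have Q: "1 - n \<le> int ?Q" using len[of 0 n] by simp
    \<comment> \<open>Both windows end at \<open>x 0\<close>, and both indices have distance
      \<open>- n\<close> from the right end; the longer window is cut where the shorter one
      starts.\<close>
    have "\<sigma> (map x [a..0]) ! i = \<sigma> (map x [n..0]) ! nat (n - 1 + int ?Q)"
    proof (cases "a \<le> n")
      case True
      then have "\<sigma> (map x [a..0]) = \<sigma> (map x [a..n - 1]) @ \<sigma> (map x [n..0])"
        using split[of a "n - 1" 0] n(1) by simp
      moreover have "i = length (\<sigma> (map x [a..n - 1])) + nat (n - 1 + int ?Q)"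
        using calculation n Q by simp
      ultimately show ?thesis by (simp only: nth_append_length_plus)
    next
      case False
      then have "\<sigma> (map x [n..0]) = \<sigma> (map x [n..a - 1]) @ \<sigma> (map x [a..0])"
        using split[of n "a - 1" 0] ab by simp
      moreover have "nat (n - 1 + int ?Q) = length (\<sigma> (map x [n..a - 1])) + i"
        using calculation by (simp add: n_def)
      ultimately show ?thesis by (simp only: nth_append_length_plus)
    qed
    also have "\<dots> = rev (\<sigma> (map x [n..0])) ! nat (- n)"
      using n(1) Q by (subst rev_nth) (auto intro!: arg_cong[where f = "nth _"])
    also have "\<dots> = biinf_image \<sigma> x n" using n(1) by (simp add: biinf_image_def)
    finally show ?thesis using True by (simp add: ab_split nth_append n_def)
  next
    case False
    then have n: "1 \<le> n" "i - ?P = nat (n - 1)" unfolding n_def by auto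
    have Q: "nat n \<le> length (\<sigma> (map x [1..n]))" using len[of n 1] by simp
    have R: "nat (n - 1) < length (\<sigma> (map x [1..b]))" using n(2) i False by (simp add: ab_split)
    have "\<sigma> (map x [1..b]) ! nat (n - 1) = \<sigma> (map x [1..n]) ! nat (n - 1)"
    proof (cases "b \<le> n")
      case True
      then show ?thesis using split[of 1 b n] R ab by (simp add: nth_append)
    next
      case False
      then show ?thesis using split[of 1 n b] Q n(1) by (simp add: nth_append)
    qed
    also have "\<dots> = biinf_image \<sigma> x n" using n(1) by (simp add: biinf_image_def)
    finally show ?thesis using False n(2) by (simp add: ab_split nth_append n_def)
  qed
qed

text \<open>Both sides are read from the single word \<open>\<sigma> (map x [a..b])\<close>. Its
  origin lies after the image of \<open>x 0\<close> for \<open>x\<close> and after that of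
  \<open>x j\<close> for the translate; the image of the letters in between is the
  displacement.\<close>

lemma biinf_image_translate:
  assumes x: "\<And>i. x i \<in> A" and "0 \<le> j"
  shows "biinf_image \<sigma> (\<lambda>i. x (i + j)) n = biinf_image \<sigma> x (n + int (length (\<sigma> (map x [1..j]))))"
proof -
  let ?z = "\<lambda>i. x (i + j)"
  \<comment> \<open>Every letter has a non-empty image, so \<open>\<bar>n\<bar>\<close> letters on
    either side suffice to reach coordinate \<open>n\<close> from both origins.\<close>
  define a where "a = - \<bar>n\<bar>"
  define b where "b = \<bar>n\<bar> + j"
  note split = image_upto_append[of x, OF x] and len = length_image_upto[of x, OF x]
  let ?P = "length (\<sigma> (map x [a..0]))" and ?q = "length (\<sigma> (map x [1..j]))"
  have Pq: "length (\<sigma> (map x [a..j])) = ?P + ?q"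
    using split[of a 0 j] assms(2) by (simp add: a_def)
  define i where "i = nat (n - 1 + int ?P + int ?q)"
  have nonneg: "0 \<le> n - 1 + int ?P + int ?q" using len[of 0 a] by (simp add: a_def)
  have "length (\<sigma> (map x [a..b])) = ?P + ?q + length (\<sigma> (map x [j + 1..b]))"
    using split[of a j b] Pq assms(2) by (simp add: a_def b_def)
  then have i: "i < length (\<sigma> (map x [a..b]))"
    using len[of b "j + 1"] nonneg by (simp add: i_def b_def)
  have "biinf_image \<sigma> x (n + int ?q) = \<sigma> (map x [a..b]) ! i"
    using biinf_image_window[of x, OF x _ _ i] assms(2) nonneg by (simp add: i_def a_def b_def algebra_simps)
  moreover have "map ?z [a - j..b - j] = map x [a..b]" "map ?z [a - j..0] = map x [a..j]"
    by (simp_all add: map_upto_shift)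
  then have "biinf_image \<sigma> ?z n = \<sigma> (map x [a..b]) ! i"
    using biinf_image_window[of ?z "a - j" "b - j" i] i x assms(2) Pq nonneg
    by (simp add: i_def a_def b_def algebra_simps)
  ultimately show ?thesis by simp
qed

text \<open>Coordinate \<open>n\<close> involves only letters between the origin and
  \<open>n\<close>. This is the continuity used to pass to limits.\<close>

lemma biinf_image_local:
  assumes "\<And>i. \<bar>i\<bar> \<le> N \<Longrightarrow> x i = x' i" "\<bar>n\<bar> \<le> N"
  shows "biinf_image \<sigma> x n = biinf_image \<sigma> x' n"
proof -
  have "map x [1..n] = map x' [1..n]" "n \<le> 0 \<Longrightarrow> map x [n..0] = map x' [n..0]"
    using assms by auto
  then show ?thesis by (cases "1 \<le> n") (simp_all add: biinf_image_def del: map_eq_conv)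
qed

lemma biinf_image_word:
  assumes x: "\<And>i. x i \<in> A" and ab: "a \<le> 1" "0 \<le> b"
    and m: "1 - int (length (\<sigma> (map x [a..0]))) \<le> m"
    and mn: "m + int n - 1 \<le> int (length (\<sigma> (map x [1..b])))"
  shows "sublist (map (biinf_image \<sigma> x) [m..m + int n - 1]) (\<sigma> (map x [a..b]))"
proof -
  define k where "k = nat (m - 1 + int (length (\<sigma> (map x [a..0]))))"
  have len: "length (\<sigma> (map x [a..b])) = length (\<sigma> (map x [a..0])) + length (\<sigma> (map x [1..b]))"
    using image_upto_append[of x, OF x, of a 0 b] ab by simp
  have "map (biinf_image \<sigma> x) [m..m + int n - 1] = take n (drop k (\<sigma> (map x [a..b])))"
  proof (rule nth_equalityI)
    show "length (map (biinf_image \<sigma> x) [m..m + int n - 1]) = length (take n (drop k (\<sigma> (map x [a..b]))))"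
      using len m mn by (simp add: k_def)
  next
    fix i assume "i < length (map (biinf_image \<sigma> x) [m..m + int n - 1])"
    then have i: "i < n" by simp
    then have ki: "k + i < length (\<sigma> (map x [a..b]))" using len m mn by (simp add: k_def)
    have "m + int i = int (k + i) + 1 - int (length (\<sigma> (map x [a..0])))" using m by (simp add: k_def)
    then have "biinf_image \<sigma> x (m + int i) = \<sigma> (map x [a..b]) ! (k + i)"
      using biinf_image_window[of x, OF x ab ki] by metis
    then show "map (biinf_image \<sigma> x) [m..m + int n - 1] ! i = take n (drop k (\<sigma> (map x [a..b]))) ! i"
      using i ki by (simp add: nth_upto)
  qed
  then show ?thesis using sublist_take_drop by metis
qed

lemma sublist_biinf_image:
  assumes x: "\<And>i. x i \<in> A"
  obtains a b where "sublist (map (biinf_image \<sigma> x) [m..m + int n - 1]) (\<sigma> (map x [a..b]))"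
    "a \<le> b"
proof
  note len = length_image_upto[of x, OF x]
  show "sublist (map (biinf_image \<sigma> x) [m..m + int n - 1]) (\<sigma> (map x [- \<bar>m\<bar>..\<bar>m\<bar> + int n]))"
    using len[of 0 "- \<bar>m\<bar>"] len[of "\<bar>m\<bar> + int n" 1]
    by (intro biinf_image_word x) auto
qed simp

lemma biinf_image_range:
  assumes x: "\<And>i. x i \<in> A"
  shows "biinf_image \<sigma> x n \<in> B"
proof -
  obtain a b where "sublist (map (biinf_image \<sigma> x) [n..n + int 1 - 1]) (\<sigma> (map x [a..b]))"
    using sublist_biinf_image[of x, OF x] by metis
  then have "biinf_image \<sigma> x n \<in> set (\<sigma> (map x [a..b]))"
    using set_mono_sublist by fastforce
  then show ?thesis using image_lists[OF word_in_lists[of x, OF x]] by auto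
qed

lemma biinf_image_in_image_subshift:
  assumes "subshift A X" "x \<in> X"
  shows "biinf_image \<sigma> x \<in> image_subshift B \<sigma> X"
proof -
  note x = subshift_range[OF assms]
  have "\<exists>w\<in>language X. sublist u (\<sigma> w)" if "biinf_factor u (biinf_image \<sigma> x)" for u
  proof -
    obtain m where u: "u = map (biinf_image \<sigma> x) [m..m + int (length u) - 1]"
      using \<open>biinf_factor u _\<close> by (auto simp: biinf_factor_iff)
    obtain a b where ab: "sublist u (\<sigma> (map x [a..b]))" "a \<le> b"
      using sublist_biinf_image[of x m "length u", OF x] u by metis
    then have "map x [a..b] = map x [a..a + int (length (map x [a..b])) - 1]" by simp
    then have "map x [a..b] \<in> language X"
      unfolding language_def biinf_factor_iff using assms(2) by blast
    then show ?thesis using ab(1) by blast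
  qed
  then show ?thesis
    using biinf_image_range[of x, OF x] by (simp add: image_subshift_def topspace_full_shift)
qed

lemma image_subshift_range: "y \<in> image_subshift B \<sigma> X \<Longrightarrow> y i \<in> B"
  by (simp add: image_subshift_def topspace_full_shift)

section \<open>Recognizability and the lower bound\<close>

text \<open>Counterexamples for every \<open>N\<close> cluster at a pair in \<open>X\<close> with
  equal images, so recognizability makes the two limits equal. Yet their letters at 1 are those of
  some counterexample and therefore differ. The window takes \<open>N\<close> coordinates on either
  side of the start of the image of \<open>x 1\<close>.\<close>

lemma recognizable_window:
  assumes "finite A" "subshift A X" "recognizable B \<sigma> X"
  shows "\<exists>N. \<forall>x\<in>X. \<forall>x'\<in>X.
    (\<forall>i. 1 - int N \<le> i \<and> i \<le> int N \<longrightarrow> biinf_image \<sigma> x i = biinf_image \<sigma> x' i) \<longrightarrow> x 1 = x' 1"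
proof (rule ccontr)
  assume "\<not> ?thesis"
  then have "\<forall>N. \<exists>x x'. x \<in> X \<and> x' \<in> X \<and> x 1 \<noteq> x' 1 \<and>
      (\<forall>i. 1 - int N \<le> i \<and> i \<le> int N \<longrightarrow> biinf_image \<sigma> x i = biinf_image \<sigma> x' i)" by blast
  then obtain f g where fg: "\<And>N. f N \<in> X" "\<And>N. g N \<in> X" "\<And>N. f N 1 \<noteq> g N 1"
    and agree: "\<And>N i. 1 - int N \<le> i \<Longrightarrow> i \<le> int N \<Longrightarrow> biinf_image \<sigma> (f N) i = biinf_image \<sigma> (g N) i"
    by metis
  \<comment> \<open>Clustering pairs makes both sequences converge along common indices.\<close>
  have "\<exists>z. \<forall>N::nat. \<exists>n\<ge>N. \<forall>i. \<bar>i\<bar> \<le> int N \<longrightarrow> (f n i, g n i) = z i"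
    using assms(1) fg(1,2) subshift_range[OF assms(2)]
    by (intro biinfinite_cluster_word[of "A \<times> A"]) auto
  then obtain z where z: "\<And>N::nat. \<exists>n\<ge>N. \<forall>i. \<bar>i\<bar> \<le> int N \<longrightarrow> (f n i, g n i) = z i" by blast
  define x where "x = fst \<circ> z"
  define x' where "x' = snd \<circ> z"
  have lim: "\<exists>n\<ge>N. \<forall>i. \<bar>i\<bar> \<le> int N \<longrightarrow> f n i = x i \<and> g n i = x' i" for N
  proof -
    obtain n where "n \<ge> N" "\<forall>i. \<bar>i\<bar> \<le> int N \<longrightarrow> (f n i, g n i) = z i" using z by blast
    then have "\<forall>i. \<bar>i\<bar> \<le> int N \<longrightarrow> f n i = x i \<and> g n i = x' i"
      by (metis comp_apply fst_conv snd_conv x'_def x_def)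
    then show ?thesis using \<open>n \<ge> N\<close> by blast
  qed
  have A: "x i \<in> A" "x' i \<in> A" for i
  proof -
    obtain n where "f n i = x i" "g n i = x' i" using lim[of "nat \<bar>i\<bar>"] by auto
    then show "x i \<in> A" "x' i \<in> A" using subshift_range[OF assms(2)] fg(1,2) by metis+
  qed
  have X: "x \<in> X" "x' \<in> X"
    using subshift_limit[OF assms(2) A(1)] subshift_limit[OF assms(2) A(2)] lim fg(1,2) by meson+
  have "biinf_image \<sigma> x i = biinf_image \<sigma> x' i" for i
  proof -
    \<comment> \<open>The extra 1 accounts for the left end \<open>1 - int n\<close> of the window
      of agreement.\<close>
    obtain n where n: "n \<ge> nat \<bar>i\<bar> + 1" "\<forall>j. \<bar>j\<bar> \<le> int (nat \<bar>i\<bar> + 1) \<longrightarrow> f n j = x j \<and> g n j = x' j"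
      using lim by blast
    have "biinf_image \<sigma> x i = biinf_image \<sigma> (f n) i"
      using n(2) by (intro biinf_image_local[of "\<bar>i\<bar>"]) auto
    also have "\<dots> = biinf_image \<sigma> (g n) i" using n(1) by (intro agree) auto
    also have "\<dots> = biinf_image \<sigma> x' i"
      using n(2) by (intro biinf_image_local[of "\<bar>i\<bar>"]) auto
    finally show ?thesis .
  qed
  then have eq: "biinf_image \<sigma> x = biinf_image \<sigma> x'" by blast
  have "biinf_image \<sigma> x \<in> topspace (full_shift B)"
    using biinf_image_range[of x, OF A(1)] by (simp add: topspace_full_shift)
  moreover have "0 < length (\<sigma> [x 1])" "0 < length (\<sigma> [x' 1])"
    using image_letter A by (simp_all add: Suc_le_eq)
  ultimately have "x = x' \<and> (0::nat) = 0"
    using assms(3) X eq unfolding recognizable_def by (metis funpow_0)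
  moreover obtain n where "f n 1 = x 1" "g n 1 = x' 1" using lim[of 1] by (metis abs_one of_nat_1 order.refl)
  ultimately show False using fg(3) by metis
qed

text \<open>Letting \<open>m\<close> and \<open>n\<close> vary independently covers both lower
  bounds: \<open>m = n\<close> with \<open>M = 1\<close> in the letter-to-letter case, and
  \<open>m\<close> the integer quotient of \<open>n\<close> by \<open>M\<close> in general.\<close>

lemma complexity_le_complexity_image:
  assumes "finite A" "finite B" "subshift A X" "recognizable B \<sigma> X"
    and M: "\<And>a. a \<in> A \<Longrightarrow> length (\<sigma> [a]) \<le> M"
  shows "\<exists>K>0. \<forall>m n. M * m \<le> n \<longrightarrow> complexity X m \<le> K * complexity (image_subshift B \<sigma> X) n"
proof -
  obtain N where N: "\<And>x x'. x \<in> X \<Longrightarrow> x' \<in> X \<Longrightarrow>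
      (\<And>i. 1 - int N \<le> i \<Longrightarrow> i \<le> int N \<Longrightarrow> biinf_image \<sigma> x i = biinf_image \<sigma> x' i) \<Longrightarrow> x 1 = x' 1"
    using recognizable_window[OF assms(1,3,4)] by metis
  define W where "W = {w. set w \<subseteq> A \<and> length w \<le> N}"
  have W: "finite W" "[] \<in> W" using finite_lists_length_le[OF assms(1)] by (auto simp: W_def)
  let ?Y = "image_subshift B \<sigma> X"
  have "complexity X m \<le> (card W * card W) * complexity ?Y n" if mn: "M * m \<le> n" for m n
  proof -
    let ?L = "{w \<in> language X. length w = m}" and ?R = "{u \<in> language ?Y. length u = n}"
    have "\<forall>w\<in>?L. \<exists>x\<in>X. w = map x [1..int m]" by (auto simp: language_length_eq[OF assms(3)])
    then obtain s where s: "\<And>w. w \<in> ?L \<Longrightarrow> s w \<in> X" "\<And>w. w \<in> ?L \<Longrightarrow> w = map (s w) [1..int m]"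
      by metis
    \<comment> \<open>For \<open>m < N\<close>, truncated subtraction makes both boundary words
      equal to \<open>w\<close>.\<close>
    define F where "F = (\<lambda>w. (map (biinf_image \<sigma> (s w)) [1..int n], take N w, drop (m - N) w))"
    have "F ` ?L \<subseteq> ?R \<times> W \<times> W"
    proof
      fix t assume "t \<in> F ` ?L"
      then obtain w where w: "w \<in> ?L" "t = F w" by blast
      have "map (biinf_image \<sigma> (s w)) [1..int n] \<in> language ?Y"
        using biinf_image_in_image_subshift[OF assms(3) s(1)[OF w(1)]]
        unfolding language_def biinf_factor_iff
        by (auto intro!: bexI[of _ "biinf_image \<sigma> (s w)"] exI[of _ 1])
      moreover have "set w \<subseteq> A"
        using language_lists[of X A w] subshift_range[OF assms(3)] w(1) by auto
      then have "take N w \<in> W" "drop (m - N) w \<in> W"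
        using w(1) set_take_subset[of N w] set_drop_subset[of "m - N" w] by (auto simp: W_def)
      ultimately show "t \<in> ?R \<times> W \<times> W" by (simp add: w(2) F_def)
    qed
    moreover have "inj_on F ?L"
    proof (rule inj_onI)
      fix w w' assume w: "w \<in> ?L" "w' \<in> ?L" and eq: "F w = F w'"
      define x where "x = s w"
      define x' where "x' = s w'"
      have X: "x \<in> X" "x' \<in> X" and wx: "w = map x [1..int m]" "w' = map x' [1..int m]"
        using s w by (auto simp: x_def x'_def)
      note xA = subshift_range[OF assms(3) X(1)] and xA' = subshift_range[OF assms(3) X(2)]
      have nth: "w ! j = x (1 + int j)" "w' ! j = x' (1 + int j)" if "j < m" for j
        using that by (simp_all add: wx nth_upto)
      have win: "biinf_image \<sigma> x i = biinf_image \<sigma> x' i" if "1 \<le> i" "i \<le> int n" for i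
        using eq that by (simp add: F_def x_def x'_def)
      have "x (1 + int j) = x' (1 + int j)" if "j < m" for j
        using that
      proof (induction j rule: less_induct)
        case (less j)
        consider "j < N" | "m - N \<le> j" | "N \<le> j" "j + N < m" by linarith
        then show ?case
        proof cases
          case 1
          have "take N w ! j = take N w' ! j" using eq by (simp add: F_def)
          then show ?thesis using 1 nth less.prems by simp
        next
          case 2
          have "drop (m - N) w ! (j - (m - N)) = drop (m - N) w' ! (j - (m - N))"
            using eq by (simp add: F_def)
          then show ?thesis using 2 nth less.prems w by simp
        next
          case 3
          \<comment> \<open>By strong induction the earlier letters agree, so the image of the
            letter at \<open>1 + int j\<close> starts at coordinate \<open>p + 1\<close> for
            \<open>x\<close> and for \<open>x'\<close>.\<close>
          have same: "map x [1..int j] = map x' [1..int j]"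
          proof (rule map_cong)
            fix i assume "i \<in> set [1..int j]"
            then have "nat (i - 1) < j" "i = 1 + int (nat (i - 1))" by auto
            then show "x i = x' i" using less.IH[of "nat (i - 1)"] less.prems by simp
          qed simp
          define p where "p = length (\<sigma> (map x [1..int j]))"
          have "int j \<le> int p"
            using length_image_upto[of x "int j" 1, OF xA] by (simp add: p_def)
          \<comment> \<open>The right end of the window stays within the known letters: the more
            than \<open>N\<close> remaining letters add at least \<open>N\<close> to
            \<open>p\<close>, and the whole image has length at most \<open>M * m \<le> n\<close>.
            On the left, \<open>N \<le> j \<le> p\<close> suffices.\<close>
          moreover have "int p + int N \<le> int n"
          proof -
            have "length (\<sigma> w) = p + length (\<sigma> (map x [int j + 1..int m]))"
              using image_upto_append[of x, OF xA, of 1 "int j" "int m"] 3 by (simp add: wx p_def)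
            moreover have "length (\<sigma> w) \<le> M * m"
              using length_image_le[OF M word_in_lists[of x, OF xA], of 1 "int m"] by (simp add: wx)
            moreover have "m - j \<le> length (\<sigma> (map x [int j + 1..int m]))"
              using length_image_upto[of x "int m" "int j + 1", OF xA] by linarith
            ultimately show ?thesis using 3 mn by linarith
          qed
          ultimately have "biinf_image \<sigma> (\<lambda>i. x (i + int j)) i = biinf_image \<sigma> (\<lambda>i. x' (i + int j)) i"
            if "1 - int N \<le> i" "i \<le> int N" for i
            using that 3 win[of "i + int p"]
            by (simp add: biinf_image_translate[of x, OF xA] biinf_image_translate[of x', OF xA'] p_def
                same del: map_eq_conv)
          then show ?thesis
            using N[OF subshift_translate[OF assms(3) X(1)] subshift_translate[OF assms(3) X(2)]] by simp
        qed
      qed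
      then show "w = w'" using nth w by (intro nth_equalityI) auto
    qed
    moreover have "finite ?R"
      using finite_language_length[OF assms(2)] image_subshift_range by blast
    ultimately have "card ?L \<le> card (?R \<times> W \<times> W)"
      using W(1) by (intro card_inj_on_le) auto
    then show ?thesis by (simp add: complexity_def mult.commute mult.left_commute card_cartesian_product)
  qed
  moreover have "card W * card W > 0" using W by (auto simp: card_gt_0_iff)
  ultimately show ?thesis by blast
qed

end

section \<open>Complexity at length zero and of full shifts\<close>

text \<open>Length 0 is treated apart because \<open>complexity_image_le\<close> concerns positive
  lengths.\<close>

lemma complexity_0: "X \<noteq> {} \<Longrightarrow> complexity X 0 = 1"
proof -
  assume "X \<noteq> {}"
  then have "{w \<in> language X. length w = 0} = {[]}"
    by (auto simp: language_def biinf_factor_def)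
  then show ?thesis by (simp add: complexity_def)
qed

lemma complexity_0_le: "complexity X 0 \<le> 1"
proof -
  have "{w \<in> language X. length w = 0} \<subseteq> {[]}" by auto
  then show ?thesis unfolding complexity_def by (metis card.empty card_insert_disjoint card_mono finite.emptyI finite.insertI empty_iff One_nat_def)
qed

lemma subshift_full_shift: "a \<in> A \<Longrightarrow> subshift A (topspace (full_shift A))"
  unfolding subshift_def
proof (intro conjI)
  show "shift_op ` topspace (full_shift A) = topspace (full_shift A)"
  proof (intro equalityI subsetI)
    fix x assume "x \<in> topspace (full_shift A)"
    moreover have "x = shift_op (\<lambda>i. x (i - 1))" by (simp add: shift_op_def)
    ultimately show "x \<in> shift_op ` topspace (full_shift A)"
      by (intro image_eqI[of _ _ "\<lambda>i. x (i - 1)"]) (auto simp: topspace_full_shift)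
  qed (auto simp: topspace_full_shift shift_op_def)
  show "closedin (full_shift A) (topspace (full_shift A))" by (rule closedin_topspace)
qed (auto simp: topspace_full_shift)

lemma complexity_full_shift:
  assumes "finite A" "a \<in> A"
  shows "complexity (topspace (full_shift A)) n = card A ^ n"
proof -
  have "(\<lambda>x. map x [1..int n]) ` topspace (full_shift A) = {w. set w \<subseteq> A \<and> length w = n}"
  proof (intro equalityI subsetI)
    fix w assume w: "w \<in> {w. set w \<subseteq> A \<and> length w = n}"
    define x where "x = (\<lambda>i. if 1 \<le> i \<and> i \<le> int n then w ! nat (i - 1) else a)"
    have "w = map x [1..int n]"
      using w by (intro nth_equalityI) (auto simp: x_def nth_upto)
    moreover have "x \<in> topspace (full_shift A)"
      using w assms(2) nth_mem[of _ w] by (auto simp: x_def topspace_full_shift subset_iff)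
    ultimately show "w \<in> (\<lambda>x. map x [1..int n]) ` topspace (full_shift A)" by blast
  qed (auto simp: topspace_full_shift)
  then show ?thesis
    using card_lists_length_eq[OF assms(1)] language_length_eq[OF subshift_full_shift[OF assms(2)]]
    by (simp add: complexity_def)
qed

section \<open>A recognizable morphism whose image has much smaller complexity\<close>

definition pad_zero :: "nat list \<Rightarrow> nat list" where
  "pad_zero w = concat (map (\<lambda>a. [0, a]) w)"

interpretation pad_zero: non_erasing_morphism "{1, 2}" "{0, 1, 2}" pad_zero
  by unfold_locales
    (auto simp: free_monoid_morphism_def non_erasing_def pad_zero_def split: if_splits)

text \<open>Coordinates 1 and 2 are computed directly; moving \<open>x\<close> by \<open>j\<close>
  letters moves its image by \<open>2 * j\<close> and reaches all others.\<close>

lemma biinf_image_pad_zero: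
  assumes x: "\<And>i. x i \<in> {1, 2}"
  shows "biinf_image pad_zero x (2 * i) = x i" "biinf_image pad_zero x (2 * i - 1) = 0"
proof -
  have base: "biinf_image pad_zero z 2 = z 1" "biinf_image pad_zero z 1 = 0" for z
    by (simp_all add: biinf_image_def pad_zero_def upto.simps)
  have len: "length (pad_zero w) = 2 * length w" for w
    by (induction w) (auto simp: pad_zero_def)
  have step: "biinf_image pad_zero x (n + 2 * j) = biinf_image pad_zero (\<lambda>i. x (i + j)) n"
    if "\<And>i. x i \<in> {1, 2}" "0 \<le> j" for x n j
    using pad_zero.biinf_image_translate[of x j n] that by (simp add: len mult.commute)
  have "biinf_image pad_zero x (n + 2 * j) = biinf_image pad_zero (\<lambda>i. x (i + j)) n" for n j
  proof (cases "0 \<le> j")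
    case False
    \<comment> \<open>For negative \<open>j\<close>, the forward rule is applied to the translated
      word, which \<open>- j\<close> moves back to \<open>x\<close>.\<close>
    then show ?thesis using step[of "\<lambda>i. x (i + j)" "- j" "n + 2 * j"] x by simp
  qed (use step[OF x] in simp)
  from this[of 2 "i - 1"] this[of 1 "i - 1"]
  show "biinf_image pad_zero x (2 * i) = x i" "biinf_image pad_zero x (2 * i - 1) = 0"
    by (simp_all add: base algebra_simps)
qed

text \<open>Different offsets would match a 0 with a letter 1 or 2. For equal offsets the even
  coordinates of the images return \<open>x\<close> and \<open>x'\<close>.\<close>

lemma recognizable_pad_zero: "recognizable {0, 1, 2} pad_zero (topspace (full_shift {1, 2}))"
  unfolding recognizable_def
proof (intro ballI allI impI)
  fix x x' y k l
  assume "x \<in> topspace (full_shift {1, 2})" "x' \<in> topspace (full_shift {1, 2})"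
    and "k < length (pad_zero [x 1])" "l < length (pad_zero [x' 1])"
    and y: "y = (shift_op ^^ k) (biinf_image pad_zero x)" "y = (shift_op ^^ l) (biinf_image pad_zero x')"
  then have x: "\<And>i. x i \<in> {1, 2}" "\<And>i. x' i \<in> {1, 2}" and kl: "k < 2" "l < 2"
    by (auto simp: topspace_full_shift pad_zero_def)
  have eq: "biinf_image pad_zero x (i + int k) = biinf_image pad_zero x' (i + int l)" for i
    using y by (metis shift_op_funpow)
  note img = biinf_image_pad_zero[of x, OF x(1)] biinf_image_pad_zero[of x', OF x(2)]
  have "k = l"
  proof (rule ccontr)
    assume "k \<noteq> l"
    then consider "k = 0" "l = 1" | "k = 1" "l = 0" using kl by linarith
    then show False
    proof cases
      case 1
      then show False using eq[of 1] img(2)[of 1] img(3)[of 1] x(2)[of 1] by auto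
    next
      case 2
      then show False using eq[of 1] img(1)[of 1] img(4)[of 1] x(1)[of 1] by auto
    qed
  qed
  moreover have "x i = x' i" for i
    using eq[of "2 * i - int k"] img(1)[of i] img(3)[of i] \<open>k = l\<close> by simp
  ultimately show "x = x' \<and> k = l" by blast
qed

lemma infinite_complexity_pad_zero:
  fixes c :: real
  assumes "c > 0"
  shows "infinite {n. c * real (complexity (topspace (full_shift {1, 2 :: nat})) n) >
    real (complexity (image_subshift {0, 1, 2} pad_zero (topspace (full_shift {1, 2}))) n)}"
proof -
  let ?X = "topspace (full_shift {1, 2 :: nat})"
  let ?Y = "image_subshift {0, 1, 2} pad_zero ?X"
  let ?S = "{n. c * real (complexity ?X n) > real (complexity ?Y n)}"
  have p: "complexity ?X n = 2 ^ n" for n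
    using complexity_full_shift[of "{1, 2 :: nat}" 1] by (simp add: numeral_2_eq_2)
  \<comment> \<open>A factor of length \<open>2 * m\<close> meets at most \<open>m + 1\<close>
    letter images of length 2, each with two possible offsets.\<close>
  have le: "complexity ?Y (2 * m) \<le> 2 * 2 ^ (m + 1)" if "m > 0" for m
    using pad_zero.complexity_image_le[of ?X 2 2 "2 * m" "m + 1"] that p subshift_full_shift[of 1 "{1, 2 :: nat}"]
    by (auto simp: pad_zero_def)
  \<comment> \<open>This makes \<open>4 * 2 ^ m\<close>, the bound for the image, smaller than
    \<open>c * 4 ^ m\<close> for all \<open>m > m0\<close>.\<close>
  obtain m0 where m0: "4 / c < 2 ^ m0" using real_arch_pow[of 2 "4 / c"] by auto
  have mem: "2 * m \<in> ?S" if m: "m > m0" for m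
  proof -
    have "real (complexity ?Y (2 * m)) \<le> real (2 * 2 ^ (m + 1))"
      using le[of m] m of_nat_mono by fastforce
    also have "\<dots> = 4 * 2 ^ m" by simp
    also have "\<dots> < (c * 2 ^ m) * 2 ^ m"
    proof -
      have "(2::real) ^ m0 \<le> 2 ^ m" using m by (intro power_increasing) auto
      then have "4 / c < 2 ^ m" using m0 by linarith
      then have "4 < c * 2 ^ m" using assms by (simp add: field_simps)
      then show ?thesis by simp
    qed
    also have "\<dots> = c * real (complexity ?X (2 * m))"
      using p[of "2 * m"] by (simp add: mult_2 power_add)
    finally show ?thesis by simp
  qed
  show ?thesis
    unfolding infinite_nat_iff_unbounded_le
  proof
    fix n
    show "\<exists>k\<ge>n. k \<in> ?S" using mem[of "Suc (m0 + n)"] by (intro exI[of _ "2 * Suc (m0 + n)"]) auto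
  qed
qed

section \<open>Deduction of the four assertions from the two bounds and the example\<close>

theorem theorem1p2:
  shows
  "(\<forall>(A :: 'a set) (B :: 'b set) (X :: (int \<Rightarrow> 'a) set) (\<sigma> :: 'a list \<Rightarrow> 'b list) (Y :: (int \<Rightarrow> 'b) set).
      finite A \<and> A \<noteq> {} \<and> finite B \<and> B \<noteq> {} \<and> subshift A X \<and>
      free_monoid_morphism A B \<sigma> \<and> non_erasing A \<sigma> \<and> Y = image_subshift B \<sigma> X \<longrightarrow>
      \<comment> \<open>(1)\<close>
      (\<exists>C::real. C > 0 \<and> (\<forall>n. real (complexity Y n) \<le> C * real (complexity X n))) \<and>
      Max ((\<lambda>a. length (\<sigma> [a])) ` A) > 0 \<and>
      (\<forall>n. complexity Y n \<le> Max ((\<lambda>a. length (\<sigma> [a])) ` A) * complexity X n) \<and>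
      \<comment> \<open>(2)\<close>
      (recognizable B \<sigma> X \<and> letter_to_letter A \<sigma> \<longrightarrow>
        (\<exists>c::real. c > 0 \<and>
          (\<forall>\<^sub>F n in sequentially. c * real (complexity X n) \<le> real (complexity Y n)))) \<and>
      \<comment> \<open>(3)\<close>
      (recognizable B \<sigma> X \<longrightarrow>
        (\<exists>(c::real) (d::real). c > 0 \<and> d > 0 \<and>
          (\<forall>\<^sub>F n in sequentially.
             c * real (complexity X (nat \<lfloor>d * real n\<rfloor>)) \<le> real (complexity Y n))))) \<and>
   \<comment> \<open>(4)\<close>
   (\<exists>(A :: nat set) (B :: nat set) (X :: (int \<Rightarrow> nat) set) (\<sigma> :: nat list \<Rightarrow> nat list).
      finite A \<and> A \<noteq> {} \<and> finite B \<and> B \<noteq> {} \<and> subshift A X \<and>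
      free_monoid_morphism A B \<sigma> \<and> non_erasing A \<sigma> \<and> recognizable B \<sigma> X \<and>
      (\<forall>c::real. c > 0 \<longrightarrow>
         infinite {n. c * real (complexity X n) > real (complexity (image_subshift B \<sigma> X) n)}))"
proof (intro conjI allI impI)
  fix A :: "'a set" and B :: "'b set" and X \<sigma> and Y :: "(int \<Rightarrow> 'b) set"
  assume hyp: "finite A \<and> A \<noteq> {} \<and> finite B \<and> B \<noteq> {} \<and> subshift A X \<and>
      free_monoid_morphism A B \<sigma> \<and> non_erasing A \<sigma> \<and> Y = image_subshift B \<sigma> X"
  then interpret non_erasing_morphism A B \<sigma> by unfold_locales auto
  let ?M = "Max ((\<lambda>a. length (\<sigma> [a])) ` A)"
  have M: "length (\<sigma> [a]) \<le> ?M" if "a \<in> A" for a using hyp that by (intro Max_ge) auto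
  obtain a where "a \<in> A" using hyp by blast
  then show M0: "?M > 0" using M[of a] image_letter[of a] by linarith
  show upper: "complexity Y n \<le> ?M * complexity X n" for n
  proof (cases "n = 0")
    case True
    have "complexity X 0 = 1" using hyp by (intro complexity_0) (simp add: subshift_def)
    then show ?thesis using True M0 complexity_0_le[of Y] by simp
  next
    case False
    \<comment> \<open>Here \<open>m = n\<close>, and \<open>r = 1\<close> comes from
      \<open>image_letter\<close>.\<close>
    then show ?thesis using hyp complexity_image_le[of X ?M 1 n n] M image_letter by auto
  qed
  show "\<exists>C::real. C > 0 \<and> (\<forall>n. real (complexity Y n) \<le> C * real (complexity X n))"
  proof (intro exI[of _ "real ?M"] conjI allI)
    show "real (complexity Y n) \<le> real ?M * real (complexity X n)" for n
      using of_nat_mono[OF upper] by simp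
  qed (use M0 in simp)
  have lower: "\<exists>c::real. c > 0 \<and> (\<forall>m n. L * m \<le> n \<longrightarrow> c * real (complexity X m) \<le> real (complexity Y n))"
    if rec: "recognizable B \<sigma> X" and L: "\<And>a. a \<in> A \<Longrightarrow> length (\<sigma> [a]) \<le> L" for L
  proof -
    obtain K where K: "K > 0" "\<And>m n. L * m \<le> n \<Longrightarrow> complexity X m \<le> K * complexity Y n"
      using complexity_le_complexity_image[of X L] hyp rec L by blast
    have "1 / real K * real (complexity X m) \<le> real (complexity Y n)" if "L * m \<le> n" for m n
    proof -
      have "real (complexity X m) \<le> real K * real (complexity Y n)"
        using of_nat_mono[OF K(2)[OF that]] by simp
      then show ?thesis using K(1) by (simp add: field_simps)
    qed
    then show ?thesis using K(1) by (intro exI[of _ "1 / real K"]) auto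
  qed
  show "\<exists>c::real. c > 0 \<and>
      (\<forall>\<^sub>F n in sequentially. c * real (complexity X n) \<le> real (complexity Y n))"
    if "recognizable B \<sigma> X \<and> letter_to_letter A \<sigma>"
  proof -
    have "length (\<sigma> [a]) \<le> 1" if "a \<in> A" for a
      using that \<open>recognizable B \<sigma> X \<and> letter_to_letter A \<sigma>\<close> by (simp add: letter_to_letter_def)
    then have "\<exists>c::real. c > 0 \<and> (\<forall>m n. 1 * m \<le> n \<longrightarrow> c * real (complexity X m) \<le> real (complexity Y n))"
      using that by (intro lower) auto
    then obtain c :: real where "c > 0" "\<forall>m n. 1 * m \<le> n \<longrightarrow> c * real (complexity X m) \<le> real (complexity Y n)"
      by blast
    then show ?thesis by (intro exI[of _ c]) simp
  qed
  show "\<exists>(c::real) (d::real). c > 0 \<and> d > 0 \<and>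
      (\<forall>\<^sub>F n in sequentially. c * real (complexity X (nat \<lfloor>d * real n\<rfloor>)) \<le> real (complexity Y n))"
    if rec: "recognizable B \<sigma> X"
  proof -
    obtain c :: real where c: "c > 0" "\<And>m n. ?M * m \<le> n \<Longrightarrow> c * real (complexity X m) \<le> real (complexity Y n)"
      using lower[OF rec M] by auto
    \<comment> \<open>With \<open>d = 1 / ?M\<close> the floor becomes the integer quotient of
      \<open>n\<close> by \<open>?M\<close>.\<close>
    have "?M * nat \<lfloor>1 / real ?M * real n\<rfloor> \<le> n" for n
      using floor_divide_of_nat_eq[where 'a = real, of n ?M] by simp
    then show ?thesis using c M0 by (intro exI[of _ c] exI[of _ "1 / real ?M"]) simp
  qed
next
  show "\<exists>(A :: nat set) (B :: nat set) (X :: (int \<Rightarrow> nat) set) (\<sigma> :: nat list \<Rightarrow> nat list).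
      finite A \<and> A \<noteq> {} \<and> finite B \<and> B \<noteq> {} \<and> subshift A X \<and>
      free_monoid_morphism A B \<sigma> \<and> non_erasing A \<sigma> \<and> recognizable B \<sigma> X \<and>
      (\<forall>c::real. c > 0 \<longrightarrow>
         infinite {n. c * real (complexity X n) > real (complexity (image_subshift B \<sigma> X) n)})"
    using subshift_full_shift[of 1 "{1, 2 :: nat}"] pad_zero.morphism pad_zero.non_erasing
      recognizable_pad_zero infinite_complexity_pad_zero
    by (intro exI[of _ "{1, 2}"] exI[of _ "{0, 1, 2}"] exI[of _ "topspace (full_shift {1, 2})"]
        exI[of _ pad_zero]) simp
qed

end
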